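(* Let $k\ge 1$ and let $f_1,f_2,\ldots,f_k$ be transcendental entire functions, each of which has the annular domain property for some $m>1$. Suppose that there is a family of functions $(\psi_m)_{m>1}$ such that, for all $j\in\{1,2,\ldots,k\}$, $f_j$ is $\psi$-regular with regularity function $\psi_m$ for every $m>1$. Let $g=f_1\circ f_2\circ\cdots\circ f_k$. Then $A_R(g)$ is a spider's web, where $R>0$ is such that $M(r,g)>r$ for $r\ge R$.
   Context: For an entire function $f$ put $M(r,f)=\max_{|z|=r}|f(z)|$ for $r>0$. $f^n$ is the $n$th iterate of $f$, and $M^n(R,f)$ is the $n$th iterate of the map $r\mapsto M(r,f)$ applied to $R$. $\mathbb N=\{1,2,\ldots\}$ and $B(0,r)=\{z\in\mathbb C:|z|<r\}$. For a transcendental entire function $f$ and $R>0$ with $M(r,f)>r$ for all $r\ge R$, define $A_R(f)=\{z\in\mathbb C: |f^n(z)|\ge M^n(R,f)\text{ for } n\in\mathbb N\}$. A set $E\subset\mathbb C$ is a spider's web if $E$ is connected and there is a sequence $(G_n)_{n\in\mathbb N}$ of bounded simply connected domains with $G_n\subset G_{n+1}$ and $\partial G_n\subset E$ for all $n\in\mathbb N$, and $\bigcup_{n\in\mathbb N}G_n=\mathbb C$. An entire function $f$ has the annular domain property for $m>1$ if there exists $R_0>0$ such that, for all $r\ge R_0$, there is a simply connected domain $G=G(r)$ with $B(0,r)\subset G\subset B(0,r^m)$ and $|f(z)|\ge M(r,f)$ for all $z\in\partial G$. A transcendental entire function $f$ is $\psi$-regular if for each $m>1$ there exist an increasing function $\psi_m$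 (real-valued, defined for all sufficiently large $r$) and $R_m>0$ such that, for all $r\ge R_m$, $\psi_m(r)\ge r$ and $M(\psi_m(r),f)\ge(\psi_m(M(r,f)))^m$. For given $m$, $\psi_m$ is then called a regularity function for $f$. *)

theory Defs
  imports "HOL-Complex_Analysis.Complex_Analysis"
begin

definition transcendental_entire :: "(complex \<Rightarrow> complex) \<Rightarrow> bool" where
  "transcendental_entire f \<longleftrightarrow>
     f holomorphic_on UNIV \<and> \<not> (\<exists>p :: complex poly. \<forall>z. f z = poly p z)"

text \<open>
  For continuous \<open>f\<close> and \<open>r \<ge> 0\<close> the supremum below is attained, since the circle is compact and
  nonempty. For \<open>r < 0\<close> the value has no meaning.
\<close>

definition max_modulus :: "real \<Rightarrow> (complex \<Rightarrow> complex) \<Rightarrow> real" where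
  "max_modulus r f = (SUP z\<in>sphere 0 r. norm (f z))"

text \<open>Used only for \<open>R > 0\<close> with \<open>max_modulus r f > r\<close> for all \<open>r \<ge> R\<close>.\<close>

definition A_set :: "real \<Rightarrow> (complex \<Rightarrow> complex) \<Rightarrow> complex set" where
  "A_set R f = {z. \<forall>n\<ge>1. norm ((f ^^ n) z) \<ge> ((\<lambda>r. max_modulus r f) ^^ n) R}"

definition simply_connected_domain :: "complex set \<Rightarrow> bool" where
  "simply_connected_domain G \<longleftrightarrow> G \<noteq> {} \<and> open G \<and> connected G \<and> simply_connected G"

definition spiders_web :: "complex set \<Rightarrow> bool" where
  "spiders_web E \<longleftrightarrow>
     connected E \<and>
     (\<exists>G :: nat \<Rightarrow> complex set.
        (\<forall>n\<ge>1. bounded (G n) \<and> simply_connected_domain (G n) \<and>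
               G n \<subseteq> G (Suc n) \<and> frontier (G n) \<subseteq> E) \<and>
        (\<Union>n\<in>{1..}. G n) = UNIV)"

definition annular_domain_property :: "real \<Rightarrow> (complex \<Rightarrow> complex) \<Rightarrow> bool" where
  "annular_domain_property m f \<longleftrightarrow>
     (\<exists>R0>0. \<forall>r\<ge>R0. \<exists>G. simply_connected_domain G \<and>
        ball 0 r \<subseteq> G \<and> G \<subseteq> ball 0 (r powr m) \<and>
        (\<forall>z\<in>frontier G. norm (f z) \<ge> max_modulus r f))"

text \<open>
  A regularity function is only required to be defined for large arguments. It is modelled by a
  total function that is (weakly) increasing on some \<open>{\<rho>..}\<close>, with arbitrary values below \<open>\<rho>\<close>.
  These values are immaterial: \<open>R\<close> can always be enlarged, and \<open>max_modulus r f\<close> tends to infinity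
  with \<open>r\<close> for every nonconstant entire \<open>f\<close>.
\<close>

definition regularity_function ::
    "(complex \<Rightarrow> complex) \<Rightarrow> real \<Rightarrow> (real \<Rightarrow> real) \<Rightarrow> bool" where
  "regularity_function f m \<psi> \<longleftrightarrow>
     (\<exists>\<rho>. mono_on {\<rho>..} \<psi>) \<and>
     (\<exists>R>0. \<forall>r\<ge>R. \<psi> r \<ge> r \<and>
        max_modulus (\<psi> r) f \<ge> \<psi> (max_modulus r f) powr m)"

definition psi_regular :: "(complex \<Rightarrow> complex) \<Rightarrow> bool" where
  "psi_regular f \<longleftrightarrow>
     transcendental_entire f \<and> (\<forall>m>1. \<exists>\<psi>. regularity_function f m \<psi>)"

end

theory Submission
  imports Defs
begin

text \<open>
  Run through the factors of \<open>g\<close> cyclically, \<open>F\<^sub>0 = f\<^sub>k, F\<^sub>1 = f\<^sub>k\<^sub>-\<^sub>1, \<dots>\<close>, and put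
  \<open>s\<^sub>n\<^sub>+\<^sub>1 = M(s\<^sub>n, F\<^sub>n)\<close> for a large \<open>s\<^sub>0\<close>. With one exponent \<open>m\<close> for all factors, let \<open>H\<^sub>n\<close> be
  the domain that the annular domain property of \<open>F\<^sub>n\<close> gives for the radius \<open>\<psi>\<^sub>m(s\<^sub>n)\<close>. Because all
  factors share the regularity function \<open>\<psi>\<^sub>m\<close>, the modulus of \<open>F\<^sub>n\<close> on the boundary of \<open>H\<^sub>n\<close> is at
  least \<open>\<psi>\<^sub>m(s\<^sub>n\<^sub>+\<^sub>1)\<close> to the power \<open>m\<close>, so this boundary is mapped outside \<open>H\<^sub>n\<^sub>+\<^sub>1\<close>. A boundary point
  of the set of points whose orbit stays in \<open>H\<^sub>0, \<dots>, H\<^sub>N\<close> therefore has its \<open>N\<close>-th image on the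
  boundary of \<open>H\<^sub>N\<close>, of modulus at least \<open>s\<^sub>N\<close>. Hence the component of
  \<open>(\<complex> - A\<^sub>R(g)) \<union> B(0, s\<^sub>0)\<close> that contains \<open>0\<close> lies in \<open>H\<^sub>0\<close>; its boundary lies in
  \<open>A\<^sub>R(g)\<close>, and so does the boundary of the simply connected domain obtained by filling its holes.

  The set \<open>A\<^sub>R(g)\<close> is a decreasing intersection of sets \<open>{|g\<^sup>n| \<ge> M\<^sup>n(R)}\<close>. By compactness and the maximum
  principle it has no nonempty compact relatively open subset. As the loops found above surround
  any two of its points, it is connected.
\<close>

section \<open>Maximum modulus and growth of entire functions\<close>

lemma holomorphic_on_funpow:
  assumes "f holomorphic_on UNIV"
  shows "(f ^^ n) holomorphic_on UNIV"
proof (induction n)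
  case 0
  then show ?case by (simp add: id_def)
next
  case (Suc n)
  then show ?case
    using holomorphic_on_compose_gen[OF Suc assms] by (simp add: comp_def)
qed

lemma norm_le_max_modulus:
  assumes "continuous_on UNIV f"
  shows "norm (f z) \<le> max_modulus (norm z) f"
proof -
  have "compact ((\<lambda>z. norm (f z)) ` sphere 0 (norm z))"
    by (intro compact_continuous_image continuous_on_norm continuous_on_subset[OF assms]) auto
  then have "bdd_above ((\<lambda>z. norm (f z)) ` sphere 0 (norm z))"
    by (intro bounded_imp_bdd_above compact_imp_bounded)
  then show ?thesis
    unfolding max_modulus_def by (intro cSUP_upper) auto
qed

lemma max_modulus_le:
  assumes "0 \<le> r" "\<And>z. norm z = r \<Longrightarrow> norm (f z) \<le> B"
  shows "max_modulus r f \<le> B"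
  unfolding max_modulus_def using assms by (intro cSUP_least) auto

lemma norm_less_max_modulus:
  assumes hol: "f holomorphic_on UNIV" and nc: "\<not> f constant_on UNIV" and "norm w < r"
  shows "norm (f w) < max_modulus r f"
proof -
  have cont: "continuous_on UNIV f"
    by (rule holomorphic_on_imp_continuous_on[OF hol])
  have le: "norm (f z) \<le> max_modulus r f" if "z \<in> ball 0 r" for z
  proof (rule maximum_modulus_frontier[of f "ball 0 r"])
    show "norm (f u) \<le> max_modulus r f" if "u \<in> frontier (ball 0 r)" for u
      using that \<open>norm w < r\<close> norm_le_max_modulus[OF cont, of u]
        norm_ge_zero[of w] by (auto simp: frontier_ball)
  qed (use that in \<open>auto intro: holomorphic_on_subset[OF hol] continuous_on_subset[OF cont]\<close>)
  \<comment> \<open>Without strictness, \<open>w\<close> would be an interior maximum of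
    \<open>norm (f z)\<close> on the disc, which the maximum principle allows only for constant
    \<open>f\<close>.\<close>
  show ?thesis
  proof (rule ccontr)
    assume "\<not> ?thesis"
    then have "\<And>z. z \<in> ball 0 r \<Longrightarrow> norm (f z) \<le> norm (f w)"
      using le by fastforce
    then have "f constant_on UNIV"
      using maximum_modulus_principle[OF hol open_UNIV connected_UNIV open_ball subset_UNIV, of w 0 r]
        \<open>norm w < r\<close> by auto
    with nc show False ..
  qed
qed

lemma norm_le_max_modulus_le:
  assumes "f holomorphic_on UNIV" "\<not> f constant_on UNIV" "norm w \<le> r"
  shows "norm (f w) \<le> max_modulus r f"
  using assms norm_less_max_modulus[of f w r] norm_le_max_modulus[of f w]
    holomorphic_on_imp_continuous_on[of f UNIV]
  by (cases "norm w = r") auto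

lemma transcendental_entire_not_constant:
  assumes "transcendental_entire f"
  shows "\<not> f constant_on UNIV"
proof
  assume "f constant_on UNIV"
  then obtain c where "\<And>z. f z = c"
    by (auto simp: constant_on_def)
  then have "\<forall>z. f z = poly [:c:] z"
    by simp
  with assms show False
    unfolding transcendental_entire_def by blast
qed

text \<open>If M(r,f) < r held for arbitrarily large r, Cauchy's estimates would kill every Taylor
  coefficient of order at least 2, so \<open>f\<close> would be an affine polynomial.\<close>

lemma max_modulus_ge_id_at_top:
  assumes "transcendental_entire f"
  shows "\<exists>T. \<forall>r\<ge>T. r \<le> max_modulus r f"
proof (rule ccontr)
  assume "\<not> ?thesis"
  then have large: "\<exists>r\<ge>T. max_modulus r f < r" for T
    by (meson not_le)
  have hol: "f holomorphic_on UNIV"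
    using assms by (simp add: transcendental_entire_def)
  then have cont: "continuous_on UNIV f"
    by (rule holomorphic_on_imp_continuous_on)
  have zero: "(deriv ^^ n) f 0 = 0" if n: "n \<ge> 2" for n
  proof (rule ccontr)
    assume "(deriv ^^ n) f 0 \<noteq> 0"
    define d where "d = norm ((deriv ^^ n) f 0)"
    have "d > 0"
      using \<open>(deriv ^^ n) f 0 \<noteq> 0\<close> by (simp add: d_def)
    \<comment> \<open>Cauchy's inequality with the bound \<open>r\<close> on the circle yields
      \<open>d * r \<le> fact n\<close>, so any such radius beyond \<open>fact n / d\<close> gives a
      contradiction. The bound \<open>r \<ge> 1\<close> permits replacing \<open>r ^ n\<close> by
      \<open>r ^ 2\<close>.\<close>
    obtain r where r: "r \<ge> max 1 (fact n / d + 1)" "max_modulus r f < r"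
      using large by blast
    then have "r \<ge> 1" "fact n / d < r" by auto
    have "d \<le> fact n * r / r ^ n"
      unfolding d_def
    proof (rule Cauchy_inequality)
      show "norm (f x) \<le> r" if "norm (0 - x) = r" for x
        using that r(2) norm_le_max_modulus[OF cont, of x] by simp
    qed (use \<open>r \<ge> 1\<close> in \<open>auto intro: holomorphic_on_subset[OF hol] continuous_on_subset[OF cont]\<close>)
    also have "\<dots> \<le> fact n * r / r ^ 2"
      using \<open>r \<ge> 1\<close> n by (intro divide_left_mono power_increasing) auto
    also have "\<dots> = fact n / r"
      using \<open>r \<ge> 1\<close> by (simp add: power2_eq_square)
    finally have "d * r \<le> fact n"
      using \<open>r \<ge> 1\<close> by (simp add: pos_le_divide_eq)
    with \<open>fact n / d < r\<close> \<open>d > 0\<close> show False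
      by (simp add: pos_divide_less_eq mult.commute)
  qed
  have "f w = poly [:f 0, deriv f 0:] w" for w
  proof -
    have "(\<lambda>n. (deriv ^^ n) f 0 / fact n * (w - 0) ^ n) sums f w"
      by (rule holomorphic_power_series[of f 0 "norm w + 1"])
         (auto intro: holomorphic_on_subset[OF hol])
    moreover have "(\<lambda>n. (deriv ^^ n) f 0 / fact n * (w - 0) ^ n) sums
        (\<Sum>n<2. (deriv ^^ n) f 0 / fact n * (w - 0) ^ n)"
      by (rule sums_finite) (auto simp: zero)
    ultimately have "f w = (\<Sum>n<2. (deriv ^^ n) f 0 / fact n * (w - 0) ^ n)"
      by (rule sums_unique2)
    then show ?thesis
      by (simp add: numeral_2_eq_2)
  qed
  with assms show False
    unfolding transcendental_entire_def by blast
qed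

section \<open>Connectedness of nested intersections of superlevel sets, and loops in them\<close>

text \<open>Separate \<open>K\<close> from \<open>L\<close> by a bounded open \<open>U\<close>. Its
  frontier is compact and misses the intersection, hence misses a single \<open>E n\<close>. So
  \<open>norm (h n z) < c n\<close> on the frontier, and by the maximum principle throughout
  \<open>U\<close>, although \<open>K\<close> lies in both \<open>U\<close> and
  \<open>E n\<close>.\<close>

lemma compact_part_of_superlevel_INT_empty:
  fixes h :: "nat \<Rightarrow> complex \<Rightarrow> complex" and c :: "nat \<Rightarrow> real"
  defines "E \<equiv> \<lambda>n. {z. c n \<le> norm (h n z)}"
  assumes hol: "\<And>n. h n holomorphic_on UNIV" and dec: "decseq E"
    and K: "compact K" and L: "closed L" and "K \<inter> L = {}" and eq: "(\<Inter>n. E n) = K \<union> L"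
  shows "K = {}"
proof (rule ccontr)
  assume "K \<noteq> {}"
  then obtain p where "p \<in> K" by blast
  have cont: "continuous_on UNIV (h n)" for n
    by (rule holomorphic_on_imp_continuous_on[OF hol])
  obtain U V where U: "open U" "compact (closure U)" "open V" "K \<subseteq> U" "L \<subseteq> V" "U \<inter> V = {}"
    using separation_normal_compact[OF K L \<open>K \<inter> L = {}\<close>] .
  have bU: "bounded U"
    by (rule bounded_subset[OF compact_imp_bounded[OF U(2)] closure_subset])
  have "closure U \<inter> V = {}"
    using U by (simp add: open_Int_closure_eq_empty Int_commute)
  then have disj: "frontier U \<inter> (K \<union> L) = {}"
    using U(1,4,5) by (auto simp: frontier_def interior_open)
  have cF: "compact (frontier U)"
    using bU by (simp add: compact_frontier_bounded)
  have neF: "frontier U \<noteq> {}"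
    using bU \<open>p \<in> K\<close> U(4) not_bounded_UNIV by (intro frontier_not_empty) auto
  have "closed (E n)" for n
    unfolding E_def by (intro closed_Collect_le continuous_on_norm cont continuous_on_const)
  then have "compact (frontier U \<inter> E n)" for n
    using cF by (simp add: compact_Int_closed)
  moreover have "(\<Inter>n. frontier U \<inter> E n) = {}"
    using disj eq by auto
  moreover have "frontier U \<inter> E n \<subseteq> frontier U \<inter> E m" if "m \<le> n" for m n
    using decseqD[OF dec that] by blast
  ultimately obtain n where n: "frontier U \<inter> E n = {}"
    using compact_nest[of "\<lambda>n. frontier U \<inter> E n"] by blast
  obtain u where u: "u \<in> frontier U" "\<And>z. z \<in> frontier U \<Longrightarrow> norm (h n z) \<le> norm (h n u)"
    using continuous_attains_sup[OF cF neF, of "\<lambda>z. norm (h n z)"]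
      continuous_on_norm[OF continuous_on_subset[OF cont subset_UNIV]] by blast
  have "norm (h n p) \<le> norm (h n u)"
  proof (rule maximum_modulus_frontier[where f = "h n" and S = U])
    show "p \<in> U" using \<open>p \<in> K\<close> U(4) by blast
  qed (use bU u(2) in \<open>auto intro: holomorphic_on_subset[OF hol] continuous_on_subset[OF cont]\<close>)
  moreover have "norm (h n u) < c n"
    using n u(1) by (force simp: E_def)
  moreover have "p \<in> E n"
    using eq \<open>p \<in> K\<close> by blast
  ultimately show False
    by (simp add: E_def)
qed

lemma connected_superlevel_INT:
  fixes h :: "nat \<Rightarrow> complex \<Rightarrow> complex" and c :: "nat \<Rightarrow> real"
  defines "E \<equiv> \<lambda>n. {z. c n \<le> norm (h n z)}"
  assumes hol: "\<And>n. h n holomorphic_on UNIV" and dec: "decseq E"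
    and loops: "\<And>x. \<exists>G. bounded G \<and> simply_connected_domain G \<and> ball 0 x \<subseteq> G \<and> frontier G \<subseteq> (\<Inter>n. E n)"
  shows "connected (\<Inter>n. E n)"
proof -
  have cont: "continuous_on UNIV (h n)" for n
    by (rule holomorphic_on_imp_continuous_on[OF hol])
  have "closed (E n)" for n
    unfolding E_def by (intro closed_Collect_le continuous_on_norm cont continuous_on_const)
  then have clA: "closed (\<Inter>n. E n)" by blast
  \<comment> \<open>Since the frontier of \<open>G\<close> lies in \<open>X\<close>, cutting
    \<open>Y\<close> with \<open>G\<close> leaves a compact piece whose complement in the
    intersection, \<open>X \<union> (Y - G)\<close>, is closed. The preceding lemma makes the piece
    empty.\<close>
  have avoid: "Y \<inter> G = {}"
    if "closed X" "closed Y" "X \<union> Y = (\<Inter>n. E n)" "X \<inter> Y = {}" "open G" "bounded G" "frontier G \<subseteq> X"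
    for X Y G
  proof -
    have "Y \<inter> G = Y \<inter> closure G"
      using that(4,5,7) closure_subset[of G] by (auto simp: frontier_def interior_open)
    then have "compact (Y \<inter> G)"
      using that(2,6) by (simp add: closed_Int_compact)
    moreover have "closed (X \<union> (Y - G))"
      using that by (intro closed_Un closed_Diff)
    ultimately show ?thesis
      using compact_part_of_superlevel_INT_empty[of h c "Y \<inter> G" "X \<union> (Y - G)"] hol dec that(3,4)
      unfolding E_def by blast
  qed
  show ?thesis
    unfolding connected_closed_set[OF clA]
  proof clarify
    fix X Y assume XY: "closed X" "closed Y" "X \<noteq> {}" "Y \<noteq> {}" "X \<union> Y = (\<Inter>n. E n)" "X \<inter> Y = {}"
    then obtain a b where ab: "a \<in> X" "b \<in> Y" by blast
    obtain G where G: "bounded G" "simply_connected_domain G" "ball 0 (norm a + norm b + 1) \<subseteq> G"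
        "frontier G \<subseteq> (\<Inter>n. E n)"
      using loops by blast
    have "a \<in> ball 0 (norm a + norm b + 1)" "b \<in> ball 0 (norm a + norm b + 1)"
      by (auto intro: add_nonneg_pos)
    then have abG: "a \<in> G" "b \<in> G" using G(3) by blast+
    \<comment> \<open>A connected loop cannot meet both closed pieces. The piece that it misses
      would avoid \<open>G\<close>, yet \<open>G\<close> contains a point of each.\<close>
    have "connected (frontier G)"
      using G(1,2) simply_connected_eq_frontier_properties[of G]
      by (auto simp: simply_connected_domain_def)
    then have "frontier G \<subseteq> X \<or> frontier G \<subseteq> Y"
      using XY G(4) connected_closedD[of "frontier G" X Y] by blast
    moreover have "open G" using G(2) by (simp add: simply_connected_domain_def)
    ultimately show False
      using avoid[of X Y G] avoid[of Y X G] XY G(1) ab abG by blast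
  qed
qed

text \<open>The set \<open>- outside C\<close> is \<open>C\<close> with its holes filled. Its
  complement is a single component of \<open>- C\<close>, which gives simple connectivity and keeps
  the new frontier inside the old one.\<close>

lemma simply_connected_domain_Compl_outside:
  fixes C :: "complex set"
  assumes "open C" "bounded C" "connected C" "C \<noteq> {}"
  shows "bounded (- outside C)" "simply_connected_domain (- outside C)"
    "C \<subseteq> - outside C" "frontier (- outside C) \<subseteq> frontier C"
proof -
  have conn: "connected (outside C)"
    by (simp add: assms connected_outside)
  have comp: "outside C \<in> components (- C)"
    using outside_in_components conn outside_bounded_nonempty[OF \<open>bounded C\<close>] by blast
  show sub: "C \<subseteq> - outside C"
    using outside_no_overlap by blast
  show bdd: "bounded (- outside C)"
    by (simp add: assms cobounded_outside)
  have op: "open (- outside C)"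
    using closed_components[OF _ comp] assms(1) by (simp add: open_Compl closed_Compl)
  have "connected (- outside C)"
    using component_complement_connected[OF assms(3) comp] .
  then have "simply_connected (- outside C)"
    using simply_connected_iff_simple[OF op bdd] conn by simp
  then show "simply_connected_domain (- outside C)"
    using op \<open>connected (- outside C)\<close> sub assms(4) by (auto simp: simply_connected_domain_def)
  show "frontier (- outside C) \<subseteq> frontier C"
    using frontier_of_components_subset[OF comp] by (simp add: frontier_complement)
qed

text \<open>Passage to the limit: each \<open>V n\<close> controls only one level
  \<open>E n\<close>, but all of them lie in the same bounded \<open>D\<close>, and this confines
  one component common to all levels.\<close>

lemma simply_connected_domain_frontier_superlevel_INT:
  fixes h :: "nat \<Rightarrow> complex \<Rightarrow> complex" and c :: "nat \<Rightarrow> real" and V :: "nat \<Rightarrow> complex set"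
  defines "E \<equiv> \<lambda>n. {z. c n \<le> norm (h n z)}"
  assumes hol: "\<And>n. h n holomorphic_on UNIV" and dec: "decseq E"
    and V: "\<And>n. open (V n)" "\<And>n. ball 0 s \<subseteq> V n" "\<And>n. V n \<subseteq> D" "\<And>n. frontier (V n) \<subseteq> E n"
    and "bounded D" "s > 0"
  shows "\<exists>G. bounded G \<and> simply_connected_domain G \<and> ball 0 s \<subseteq> G \<and> frontier G \<subseteq> (\<Inter>n. E n)"
proof -
  \<comment> \<open>These open sets increase with \<open>n\<close>, and their union is the
    complement of the intersection with the disc added. The disc guarantees that 0 belongs to
    it.\<close>
  define Q where "Q = (\<lambda>n. - E n \<union> ball 0 s)"
  have cont: "continuous_on UNIV (h n)" for n
    by (rule holomorphic_on_imp_continuous_on[OF hol])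
  have "closed (E n)" for n
    unfolding E_def by (intro closed_Collect_le continuous_on_norm cont continuous_on_const)
  then have opQ: "open (Q n)" for n
    by (auto simp: Q_def)
  have incQ: "Q m \<subseteq> Q n" if "m \<le> n" for m n
    using decseqD[OF dec that] by (auto simp: Q_def)
  have opUQ: "open (\<Union>n. Q n)" using opQ by blast
  define C where "C = connected_component_set (\<Union>n. Q n) 0"
  have opC: "open C"
    unfolding C_def by (rule open_connected_component[OF opUQ])
  have ballC: "ball 0 s \<subseteq> C"
    unfolding C_def using \<open>s > 0\<close>
    by (intro connected_component_maximal) (auto simp: Q_def)
  have "C \<subseteq> D"
  proof
    fix p assume "p \<in> C"
    moreover have "path_connected C"
      using opC connected_open_path_connected by (auto simp: C_def)
    moreover have "0 \<in> C" using ballC \<open>s > 0\<close> by auto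
    ultimately obtain \<gamma> where \<gamma>: "path \<gamma>" "path_image \<gamma> \<subseteq> C" "pathstart \<gamma> = 0" "pathfinish \<gamma> = p"
      unfolding path_connected_def by metis
    have "path_image \<gamma> \<subseteq> (\<Union>n. Q n)"
      using \<gamma>(2) connected_component_subset unfolding C_def by blast
    \<comment> \<open>A compact path in an increasing union of open sets lies in one
      \<open>Q N\<close>. That set misses the frontier of \<open>V N\<close>, which lies in
      \<open>E N\<close> and outside the disc, so a path starting at 0 cannot leave
      \<open>V N\<close>.\<close>
    then obtain I where I: "finite I" "path_image \<gamma> \<subseteq> (\<Union>n\<in>I. Q n)"
      using compactE_image[OF compact_path_image[OF \<gamma>(1)], of UNIV Q] opQ by metis
    obtain N where "\<And>n. n \<in> I \<Longrightarrow> n \<le> N"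
      using I(1) by (meson finite_nat_set_iff_bounded_le)
    then have "path_image \<gamma> \<subseteq> Q N"
      using I(2) incQ by blast
    moreover have "Q N \<inter> frontier (V N) = {}"
      using V(1,2,4)[of N] by (auto simp: Q_def frontier_def interior_open)
    ultimately have "path_image \<gamma> \<inter> frontier (V N) = {}" by blast
    moreover have "0 \<in> path_image \<gamma> \<inter> V N"
      using \<gamma>(3) pathstart_in_path_image[of \<gamma>] V(2)[of N] \<open>s > 0\<close> by auto
    ultimately have "path_image \<gamma> \<subseteq> V N"
      using connected_Int_frontier[OF connected_path_image[OF \<gamma>(1)], of "V N"] by blast
    then show "p \<in> D"
      using \<gamma>(4) pathfinish_in_path_image[of \<gamma>] V(3) by blast
  qed
  \<comment> \<open>The frontier of a component of an open set is disjoint from that open set, so it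
    lies in every \<open>E n\<close>.\<close>
  have frC: "frontier C \<subseteq> (\<Inter>n. E n)"
  proof -
    have "frontier C \<inter> (\<Union>n. Q n) = {}"
    proof -
      have "frontier C \<subseteq> frontier (\<Union>n. Q n)"
        unfolding C_def by (rule frontier_of_connected_component_subset)
      then show ?thesis
        using opUQ by (auto simp: frontier_def interior_open)
    qed
    then show ?thesis by (auto simp: Q_def)
  qed
  have "bounded C"
    using bounded_subset[OF \<open>bounded D\<close> \<open>C \<subseteq> D\<close>] .
  moreover have "connected C"
    by (simp add: C_def)
  moreover have "C \<noteq> {}"
    using ballC \<open>s > 0\<close> by force
  ultimately
  have fill: "bounded (- outside C)" "simply_connected_domain (- outside C)"
    "C \<subseteq> - outside C" "frontier (- outside C) \<subseteq> frontier C"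
    using simply_connected_domain_Compl_outside[OF opC] by blast+
  show ?thesis
    using fill ballC frC by blast
qed

lemma spiders_webI:
  assumes "connected E"
    and loops: "\<And>x. \<exists>G. bounded G \<and> simply_connected_domain G \<and> ball 0 x \<subseteq> G \<and> frontier G \<subseteq> E"
  shows "spiders_web E"
proof -
  define P where "P = (\<lambda>n G. bounded G \<and> simply_connected_domain G \<and> ball 0 (real n) \<subseteq> G \<and> frontier G \<subseteq> E)"
  have "\<exists>G. \<forall>n. P n (G n) \<and> G n \<subseteq> G (Suc n)"
  proof (rule dependent_nat_choice)
    show "\<exists>G. P 0 G" using loops[of 0] by (simp add: P_def)
    fix G n assume "P n G"
    then obtain x where "G \<subseteq> ball 0 x"
      unfolding P_def using bounded_subset_ballD by blast
    \<comment> \<open>The radius is large enough to swallow both the previous domain, which makes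
      the sequence increasing, and the next disc of the exhaustion.\<close>
    moreover obtain G' where "bounded G'" "simply_connected_domain G'" "ball 0 (max x (Suc n)) \<subseteq> G'" "frontier G' \<subseteq> E"
      using loops by blast
    ultimately have "P (Suc n) G' \<and> G \<subseteq> G'"
      unfolding P_def by (auto simp: subset_iff)
    then show "\<exists>G'. P (Suc n) G' \<and> G \<subseteq> G'" ..
  qed
  then obtain G where G: "\<And>n. P n (G n)" "\<And>n. G n \<subseteq> G (Suc n)" by blast
  have "z \<in> (\<Union>n\<in>{1..}. G n)" for z
  proof -
    obtain n where "norm z < real n" using reals_Archimedean2 by blast
    then have "z \<in> ball 0 (real (Suc n))" by simp
    then have "z \<in> G (Suc n)" using G(1)[of "Suc n"] unfolding P_def by blast
    then show ?thesis by force
  qed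
  then show ?thesis
    unfolding spiders_web_def using assms(1) G unfolding P_def by (intro conjI exI[of _ G]) auto
qed

section \<open>Writing A_R as a nested intersection\<close>

lemma decseq_iterate_superlevel:
  assumes hol: "f holomorphic_on UNIV" and nc: "\<not> f constant_on UNIV"
  shows "decseq (\<lambda>n. {z. ((\<lambda>r. max_modulus r f) ^^ n) R \<le> norm ((f ^^ n) z)})"
proof (rule decseq_SucI, rule subsetI)
  fix n z assume "z \<in> {z. ((\<lambda>r. max_modulus r f) ^^ Suc n) R \<le> norm ((f ^^ Suc n) z)}"
  \<comment> \<open>Contrapositive: a point strictly inside the disc at step \<open>n\<close> stays
    strictly inside at the next step.\<close>
  then show "z \<in> {z. ((\<lambda>r. max_modulus r f) ^^ n) R \<le> norm ((f ^^ n) z)}"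
    using norm_less_max_modulus[OF hol nc, of "(f ^^ n) z" "((\<lambda>r. max_modulus r f) ^^ n) R"]
    by (auto simp: not_less[symmetric])
qed

text \<open>The intersection also includes \<open>n = 0\<close>; that condition already follows from
  the one for \<open>n = 1\<close>.\<close>

lemma A_set_eq_INT:
  assumes "f holomorphic_on UNIV" "\<not> f constant_on UNIV"
  shows "A_set R f = (\<Inter>n. {z. ((\<lambda>r. max_modulus r f) ^^ n) R \<le> norm ((f ^^ n) z)})"
proof -
  have "{z. ((\<lambda>r. max_modulus r f) ^^ 1) R \<le> norm ((f ^^ 1) z)} \<subseteq> 
      {z. ((\<lambda>r. max_modulus r f) ^^ 0) R \<le> norm ((f ^^ 0) z)}"
    using decseqD[OF decseq_iterate_superlevel[OF assms], of 0 1] by simp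
  then have *: "R \<le> norm z" if "max_modulus R f \<le> norm (f z)" for z
    using that by auto
  show ?thesis
    unfolding A_set_def
  proof (intro set_eqI iffI; clarsimp)
    fix z n assume "\<forall>n\<ge>Suc 0. ((\<lambda>r. max_modulus r f) ^^ n) R \<le> norm ((f ^^ n) z)"
    then show "((\<lambda>r. max_modulus r f) ^^ n) R \<le> norm ((f ^^ n) z)"
      using * by (cases n) force+
  qed
qed

section \<open>Orbits under a varying sequence of maps\<close>

text \<open>A non-autonomous replacement for iteration: each factor of a composition becomes a
  separate time step.\<close>

primrec comp_seq :: "(nat \<Rightarrow> 'a \<Rightarrow> 'a) \<Rightarrow> nat \<Rightarrow> 'a \<Rightarrow> 'a" where
  "comp_seq F 0 = id"
| "comp_seq F (Suc n) = F n \<circ> comp_seq F n"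

primrec radius_seq :: "(nat \<Rightarrow> complex \<Rightarrow> complex) \<Rightarrow> real \<Rightarrow> nat \<Rightarrow> real" where
  "radius_seq F s 0 = s"
| "radius_seq F s (Suc n) = max_modulus (radius_seq F s n) (F n)"

lemma comp_seq_add: "comp_seq F (m + n) = comp_seq (\<lambda>i. F (m + i)) n \<circ> comp_seq F m"
  by (induction n) (simp_all add: o_assoc)

lemma radius_seq_add:
  "radius_seq F s (m + n) = radius_seq (\<lambda>i. F (m + i)) (radius_seq F s m) n"
  by (induction n) simp_all

lemma comp_seq_period:
  assumes "\<And>i. F (k + i) = F i"
  shows "comp_seq F (k * n) = comp_seq F k ^^ n"
proof (induction n)
  case (Suc n)
  have "comp_seq F (k * Suc n) = comp_seq F (k * n) \<circ> comp_seq F k"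
    using comp_seq_add[of F k "k * n"] by (simp add: assms)
  then show ?case
    by (simp add: Suc funpow_swap1 fun_eq_iff)
qed simp

text \<open>The fold puts the first function outermost, whereas \<open>comp_seq\<close> applies
  index 0 first; hence the reversed index. A general \<open>i\<close> serves the induction.\<close>

lemma comp_seq_rev:
  assumes "i \<le> k"
  shows "comp_seq (\<lambda>n. f (k - n)) i = foldr (\<circ>) (map f [Suc (k - i)..<Suc k]) id"
  using assms
proof (induction i)
  case (Suc i)
  have "[Suc (k - Suc i)..<Suc k] = (k - i) # [Suc (k - i)..<Suc k]"
    using Suc.prems by (subst upt_conv_Cons) (auto simp: Suc_diff_Suc)
  then show ?case
    using Suc by simp
qed simp

lemma comp_seq_cong:
  assumes "\<And>i. i < n \<Longrightarrow> F i = F' i"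
  shows "comp_seq F n = comp_seq F' n"
  using assms by (induction n) auto

lemma holomorphic_on_comp_seq:
  assumes "\<And>n. F n holomorphic_on UNIV"
  shows "comp_seq F n holomorphic_on UNIV"
proof (induction n)
  case 0
  then show ?case by (simp add: id_def)
next
  case (Suc n)
  then show ?case
    using holomorphic_on_compose_gen[OF Suc assms] by (simp add: comp_def)
qed

context
  fixes F :: "nat \<Rightarrow> complex \<Rightarrow> complex"
  assumes hol: "\<And>n. F n holomorphic_on UNIV" and nc: "\<And>n. \<not> F n constant_on UNIV"
begin

lemma norm_comp_seq_le: "norm z \<le> s \<Longrightarrow> norm (comp_seq F n z) \<le> radius_seq F s n"
  by (induction n) (auto intro: norm_le_max_modulus_le[OF hol nc])

lemma norm_comp_seq_less: "norm z < s \<Longrightarrow> norm (comp_seq F n z) < radius_seq F s n"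
  by (induction n) (auto intro: norm_less_max_modulus[OF hol nc])

text \<open>The maximum modulus of a composition is at most the result of applying the maximum
  moduli of its factors in turn.\<close>

lemma funpow_max_modulus_le_radius_seq:
  assumes period: "\<And>i. F (k + i) = F i" and "0 \<le> R" "R \<le> s"
    and grow: "\<And>r. R \<le> r \<Longrightarrow> r \<le> max_modulus r (comp_seq F k)"
  shows "((\<lambda>r. max_modulus r (comp_seq F k)) ^^ n) R \<le> radius_seq F s (k * n)"
proof -
  let ?M = "\<lambda>r. max_modulus r (comp_seq F k)"
  have period': "F (k * n + i) = F i" for n i
    by (induction n) (auto simp: period add.assoc)
  \<comment> \<open>The lower bound is carried along in the induction: it keeps the radius
    nonnegative and within the range of \<open>grow\<close>.\<close>
  have "R \<le> (?M ^^ n) R \<and> (?M ^^ n) R \<le> radius_seq F s (k * n)"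
  proof (induction n)
    case 0
    then show ?case using assms by simp
  next
    case (Suc n)
    let ?t = "radius_seq F s (k * n)"
    have "?M ((?M ^^ n) R) \<le> radius_seq F ?t k"
      using Suc \<open>0 \<le> R\<close> by (intro max_modulus_le norm_comp_seq_le) auto
    moreover have "R \<le> ?M ((?M ^^ n) R)"
      using grow[of "(?M ^^ n) R"] Suc by simp
    ultimately show ?case
      using radius_seq_add[of F s "k * n" k] by (simp add: period' add.commute[of k])
  qed
  then show ?thesis ..
qed

text \<open>A limit of points of \<open>V N\<close> has its orbit in the closures of the
  \<open>H n\<close>. Once it is outside some \<open>H m\<close> it is on that frontier, and
  \<open>esc\<close> passes this on to every later time up to \<open>N\<close>.\<close>

lemma comp_seq_domains:
  fixes H :: "nat \<Rightarrow> complex set"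
  assumes H: "\<And>n. open (H n)" "\<And>n. ball 0 (radius_seq F s n) \<subseteq> H n"
    and esc: "\<And>n z. z \<in> frontier (H n) \<Longrightarrow> F n z \<notin> H (Suc n)"
  defines "V \<equiv> \<lambda>N. {z. \<forall>n\<le>N. comp_seq F n z \<in> H n}"
  shows "open (V N)" "ball 0 s \<subseteq> V N" "V N \<subseteq> H 0"
    "frontier (V N) \<subseteq> {z. radius_seq F s N \<le> norm (comp_seq F N z)}"
proof -
  have cont: "continuous_on UNIV (comp_seq F n)" for n
    by (rule holomorphic_on_imp_continuous_on[OF holomorphic_on_comp_seq[OF hol]])
  have V_eq: "V N = (\<Inter>n\<in>{..N}. comp_seq F n -` H n)"
    by (auto simp: V_def)
  show op: "open (V N)"
    unfolding V_eq by (intro open_INT ballI open_vimage H cont) auto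
  show "ball 0 s \<subseteq> V N"
    using norm_comp_seq_less H(2) by (fastforce simp: V_def)
  show "V N \<subseteq> H 0"
    by (auto simp: V_def)
  show "frontier (V N) \<subseteq> {z. radius_seq F s N \<le> norm (comp_seq F N z)}"
  proof
    fix z assume "z \<in> frontier (V N)"
    then have z: "z \<in> closure (V N)" "z \<notin> V N"
      using op by (auto simp: frontier_def interior_open)
    have cl: "comp_seq F n z \<in> closure (H n)" if "n \<le> N" for n
    proof -
      have "comp_seq F n ` closure (V N) \<subseteq> closure (H n)"
        using that closure_subset[of "H n"]
        by (intro image_closure_subset continuous_on_subset[OF cont]) (auto simp: V_def)
      then show ?thesis using z(1) by blast
    qed
    obtain m where m: "m \<le> N" "comp_seq F m z \<notin> H m"
      using z(2) by (auto simp: V_def)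
    have "comp_seq F n z \<notin> H n" if "m \<le> n" "n \<le> N" for n
      using that
    proof (induction rule: dec_induct)
      case base
      then show ?case using m by simp
    next
      case (step n)
      then have "comp_seq F n z \<in> frontier (H n)"
        using cl[of n] H(1)[of n] by (auto simp: frontier_def interior_open)
      then show ?case using esc by simp
    qed
    then have "comp_seq F N z \<notin> H N" using m by blast
    then show "z \<in> {z. radius_seq F s N \<le> norm (comp_seq F N z)}"
      using H(2)[of N] by (auto simp: not_less[symmetric])
  qed
qed

end

section \<open>Choice of the domains from the annular domain property and regularity\<close>

lemma radius_seq_ge:
  assumes "\<And>n r. s \<le> r \<Longrightarrow> r \<le> max_modulus r (F n)"
  shows "s \<le> radius_seq F s n"
  by (induction n) (auto intro: order_trans assms)

text \<open>This lets one exponent serve finitely many functions. The threshold is raised to at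
  least 1 so that \<open>r powr m\<close> grows with the exponent.\<close>

lemma annular_domain_property_mono:
  assumes "annular_domain_property m f" "m \<le> m'"
  shows "annular_domain_property m' f"
proof -
  obtain R0 where "R0 > 0" and R0: "\<And>r. r \<ge> R0 \<Longrightarrow> \<exists>G. simply_connected_domain G \<and>
        ball 0 r \<subseteq> G \<and> G \<subseteq> ball 0 (r powr m) \<and> (\<forall>z\<in>frontier G. norm (f z) \<ge> max_modulus r f)"
    using assms(1) unfolding annular_domain_property_def by blast
  have "\<exists>G. simply_connected_domain G \<and>
        ball 0 r \<subseteq> G \<and> G \<subseteq> ball 0 (r powr m') \<and> (\<forall>z\<in>frontier G. norm (f z) \<ge> max_modulus r f)"
    if r: "r \<ge> max 1 R0" for r
  proof -
    have "r powr m \<le> r powr m'"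
      using r \<open>m \<le> m'\<close> by (intro powr_mono) auto
    then have "ball (0::complex) (r powr m) \<subseteq> ball 0 (r powr m')" by (rule subset_ball)
    then show ?thesis using R0[of r] r by (meson max.boundedE subset_trans)
  qed
  then show ?thesis
    unfolding annular_domain_property_def by (intro exI[of _ "max 1 R0"]) auto
qed

lemma eventually_annular_regular:
  assumes "transcendental_entire f" "annular_domain_property m f" "regularity_function f m \<psi>"
  shows "\<forall>\<^sub>F r in at_top. r \<le> max_modulus r f \<and> r \<le> \<psi> r \<and>
    max_modulus (\<psi> r) f \<ge> \<psi> (max_modulus r f) powr m \<and>
    (\<exists>G. simply_connected_domain G \<and> ball 0 r \<subseteq> G \<and> G \<subseteq> ball 0 (r powr m) \<and>
       (\<forall>z\<in>frontier G. norm (f z) \<ge> max_modulus r f))"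
  using max_modulus_ge_id_at_top[OF assms(1)] assms(2,3)
  unfolding annular_domain_property_def regularity_function_def eventually_conj_iff
    eventually_at_top_linorder by blast

text \<open>The domain at time \<open>n\<close> is taken for the radius \<open>\<psi>\<close> of
  \<open>radius_seq F s n\<close>, not for that radius itself. Regularity of \<open>F n\<close> then
  bounds \<open>F n\<close> on the frontier below by \<open>r (Suc n) powr m\<close>, the radius of
  a disc containing the next domain. The next radius uses the same \<open>\<psi>\<close> although
  the map has changed, which is where a shared regularity function enters.\<close>

lemma exists_comp_seq_domains:
  fixes F :: "nat \<Rightarrow> complex \<Rightarrow> complex"
  assumes grow: "\<And>n r. s \<le> r \<Longrightarrow> r \<le> max_modulus r (F n)"
    and psi: "\<And>r. s \<le> r \<Longrightarrow> r \<le> \<psi> r"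
    and reg: "\<And>n r. s \<le> r \<Longrightarrow> \<psi> (max_modulus r (F n)) powr m \<le> max_modulus (\<psi> r) (F n)"
    and ann: "\<And>n r. s \<le> r \<Longrightarrow> \<exists>G. simply_connected_domain G \<and> ball 0 r \<subseteq> G \<and>
      G \<subseteq> ball 0 (r powr m) \<and> (\<forall>z\<in>frontier G. norm (F n z) \<ge> max_modulus r (F n))"
  shows "\<exists>H. \<forall>n. open (H n) \<and> bounded (H n) \<and> ball 0 (radius_seq F s n) \<subseteq> H n \<and>
    (\<forall>z\<in>frontier (H n). F n z \<notin> H (Suc n))"
proof -
  define r where "r = (\<lambda>n. \<psi> (radius_seq F s n))"
  have s_le: "s \<le> radius_seq F s n" for n
    by (rule radius_seq_ge) (rule grow)
  then have r_ge: "radius_seq F s n \<le> r n" for n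
    by (simp add: r_def psi)
  have "\<exists>G. simply_connected_domain G \<and> ball 0 (r n) \<subseteq> G \<and>
      G \<subseteq> ball 0 (r n powr m) \<and> (\<forall>z\<in>frontier G. norm (F n z) \<ge> max_modulus (r n) (F n))" for n
    using ann[of "r n" n] s_le[of n] r_ge[of n] by simp
  then obtain H where H: "\<And>n. simply_connected_domain (H n)" "\<And>n. ball 0 (r n) \<subseteq> H n"
      "\<And>n. H n \<subseteq> ball 0 (r n powr m)"
      "\<And>n z. z \<in> frontier (H n) \<Longrightarrow> norm (F n z) \<ge> max_modulus (r n) (F n)"
    by metis
  have "F n z \<notin> H (Suc n)" if "z \<in> frontier (H n)" for n z
  proof -
    have "r (Suc n) powr m \<le> max_modulus (r n) (F n)"
      using reg[OF s_le] by (simp add: r_def)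
    also have "\<dots> \<le> norm (F n z)" by (rule H(4)[OF that])
    finally show ?thesis using H(3)[of "Suc n"] by auto
  qed
  moreover have "ball 0 (radius_seq F s n) \<subseteq> H n" for n
    using subset_ball[OF r_ge] H(2) by blast
  moreover have "bounded (H n)" for n
    by (rule bounded_subset[OF bounded_ball H(3)])
  moreover have "open (H n)" for n
    using H(1) by (simp add: simply_connected_domain_def)
  ultimately show ?thesis by blast
qed

section \<open>Assembling the loops for the composition\<close>

theorem theorem3p1:
  fixes k :: nat
    and f :: "nat \<Rightarrow> complex \<Rightarrow> complex"
    and \<psi> :: "real \<Rightarrow> real \<Rightarrow> real"
    and g :: "complex \<Rightarrow> complex"
    and R :: real
  assumes "k \<ge> 1"
    and "\<And>j. j \<in> {1..k} \<Longrightarrow> transcendental_entire (f j)"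
    and "\<And>j. j \<in> {1..k} \<Longrightarrow> \<exists>m>1. annular_domain_property m (f j)"
    and "\<And>j. j \<in> {1..k} \<Longrightarrow> psi_regular (f j)"
    and "\<And>j m. j \<in> {1..k} \<Longrightarrow> m > 1 \<Longrightarrow> regularity_function (f j) m (\<psi> m)"
    and "g = foldr (\<circ>) (map f [1..<Suc k]) id"
    and "R > 0"
    and "\<And>r. r \<ge> R \<Longrightarrow> max_modulus r g > r"
  shows "spiders_web (A_set R g)"
proof -
  \<comment> \<open>The indices run through k, k-1, ..., 1 and repeat, since the innermost factor
    \<open>f k\<close> acts first.\<close>
  define F where "F = (\<lambda>n. f (k - n mod k))"
  have idx: "k - n mod k \<in> {1..k}" for n
    using \<open>k \<ge> 1\<close> by (simp add: Suc_le_eq)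
  have period: "F (k + i) = F i" for i
    by (simp add: F_def)
  have g: "g = comp_seq F k"
  proof -
    have "comp_seq F k = comp_seq (\<lambda>n. f (k - n)) k"
      by (rule comp_seq_cong) (simp add: F_def)
    then show ?thesis
      using comp_seq_rev[of k k f] assms(6) by simp
  qed
  have holF: "F n holomorphic_on UNIV" and ncF: "\<not> F n constant_on UNIV" for n
    using assms(2)[OF idx] transcendental_entire_not_constant
    by (auto simp: F_def transcendental_entire_def)
  have hol: "g holomorphic_on UNIV"
    unfolding g by (rule holomorphic_on_comp_seq[OF holF])
  have nc: "\<not> g constant_on UNIV"
  proof
    assume "g constant_on UNIV"
    then obtain c where c: "\<And>z. g z = c" by (auto simp: constant_on_def)
    \<comment> \<open>A constant value \<open>c\<close> contradicts the growth of \<open>g\<close>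
      at a radius that is at least both \<open>R\<close> and \<open>norm c\<close>.\<close>
    have "max_modulus (max R (norm c)) g \<le> norm c"
      using \<open>R > 0\<close> c by (intro max_modulus_le) auto
    then show False using assms(8)[of "max R (norm c)"] by simp
  qed
  define E where "E = (\<lambda>n. {z. ((\<lambda>r. max_modulus r g) ^^ n) R \<le> norm ((g ^^ n) z)})"
  have A_eq: "A_set R g = (\<Inter>n. E n)" and decE: "decseq E"
    unfolding E_def by (rule A_set_eq_INT[OF hol nc], rule decseq_iterate_superlevel[OF hol nc])
  obtain \<mu> where \<mu>: "\<And>j. j \<in> {1..k} \<Longrightarrow> \<mu> j > 1 \<and> annular_domain_property (\<mu> j) (f j)"
    using assms(3) by metis
  define m where "m = Max (\<mu> ` {1..k})"
  have \<mu>_le: "\<mu> j \<le> m" if "j \<in> {1..k}" for j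
    using that by (simp add: m_def)
  have "m > 1"
    using \<mu>_le[of 1] \<mu>[of 1] \<open>k \<ge> 1\<close> by simp
  let ?good = "\<lambda>j r. r \<le> max_modulus r (f j) \<and> r \<le> \<psi> m r \<and>
    max_modulus (\<psi> m r) (f j) \<ge> \<psi> m (max_modulus r (f j)) powr m \<and>
    (\<exists>G. simply_connected_domain G \<and> ball 0 r \<subseteq> G \<and> G \<subseteq> ball 0 (r powr m) \<and>
       (\<forall>z\<in>frontier G. norm (f j z) \<ge> max_modulus r (f j)))"
  have "\<forall>j\<in>{1..k}. \<forall>\<^sub>F r in at_top. ?good j r"
    using assms(2) assms(5)[OF _ \<open>m > 1\<close>] annular_domain_property_mono \<mu> \<mu>_le
    by (intro ballI eventually_annular_regular) blast+
  then have "\<forall>\<^sub>F r in at_top. \<forall>j\<in>{1..k}. ?good j r"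
    by (intro eventually_ball_finite finite_atLeastAtMost)
  then obtain T where T: "?good j r" if "j \<in> {1..k}" "r \<ge> T" for j r
    unfolding eventually_at_top_linorder by blast
  have loops: "\<exists>G. bounded G \<and> simply_connected_domain G \<and> ball 0 x \<subseteq> G \<and> frontier G \<subseteq> (\<Inter>n. E n)" for x
  proof -
    \<comment> \<open>Starting at \<open>s\<close> covers the prescribed disc, dominates the
      iteration from \<open>R\<close>, and makes all conditions on the factors hold.\<close>
    define s where "s = Max {x, R, T}"
    have s: "x \<le> s" "R \<le> s" "T \<le> s" by (auto simp: s_def)
    have good: "?good (k - n mod k) r" if "s \<le> r" for n r
      using T[OF idx] s(3) that by auto
    have "\<exists>H. \<forall>n. open (H n) \<and> bounded (H n) \<and> ball 0 (radius_seq F s n) \<subseteq> H n \<and>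
        (\<forall>z\<in>frontier (H n). F n z \<notin> H (Suc n))"
      by (rule exists_comp_seq_domains[where \<psi> = "\<psi> m" and m = m])
         (use good in \<open>simp_all add: F_def\<close>)
    then obtain H where H: "\<And>n. open (H n)" "\<And>n. bounded (H n)"
        "\<And>n. ball 0 (radius_seq F s n) \<subseteq> H n"
        "\<And>n z. z \<in> frontier (H n) \<Longrightarrow> F n z \<notin> H (Suc n)"
      by metis
    \<comment> \<open>One application of \<open>g\<close> is \<open>k\<close> steps of
      \<open>F\<close>, so level \<open>N\<close> of \<open>E\<close> corresponds to time
      \<open>k * N\<close>.\<close>
    define V where "V = (\<lambda>N. {z. \<forall>n\<le>k * N. comp_seq F n z \<in> H n})"
    note doms = comp_seq_domains[OF holF ncF, where H = H and s = s, OF H(1,3,4)]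
    have "frontier (V N) \<subseteq> E N" for N
    proof -
      have "((\<lambda>r. max_modulus r g) ^^ N) R \<le> radius_seq F s (k * N)"
        using funpow_max_modulus_le_radius_seq[where F = F and k = k and R = R and s = s and n = N]
          holF ncF period assms(7,8) s(2)
        by (simp add: g less_imp_le)
      then show ?thesis
        using doms(4)[of "k * N"] comp_seq_period[where F = F and k = k and n = N, OF period] by (auto simp: V_def E_def g)
    qed
    then have "\<exists>G. bounded G \<and> simply_connected_domain G \<and> ball 0 s \<subseteq> G \<and> frontier G \<subseteq> (\<Inter>n. E n)"
      unfolding E_def
    proof (intro simply_connected_domain_frontier_superlevel_INT[where V = V and D = "H 0"])
      show "s > 0" using s(2) \<open>R > 0\<close> by simp
    qed (use doms(1-3) H(2) holomorphic_on_funpow[OF hol] decE in \<open>auto simp: V_def E_def\<close>)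
    then show ?thesis
      using subset_ball[OF s(1), of 0] by (meson subset_trans)
  qed
  show ?thesis
    unfolding A_eq
  proof (rule spiders_webI)
    show "connected (\<Inter>n. E n)"
      using connected_superlevel_INT[of "\<lambda>n. g ^^ n" "\<lambda>n. ((\<lambda>r. max_modulus r g) ^^ n) R"]
        holomorphic_on_funpow[OF hol] decE loops
      unfolding E_def by blast
  qed (rule loops)
qed

end
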